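(* Every $\mathbf{FinSet}$-recognizable language of $\lambda$-terms is syntactically recognizable: for every simple type $A$, finite set $Q$ and subset $F\subseteq[\![A]\!]_Q$, there exist a simple type $B$ and a closed term $r\in\mathrm{Tm}(A[B]\to\mathrm{Bool})$ such that $\{t\in\mathrm{Tm}(A)\mid[\![t]\!]_Q\in F\} = \{t\in\mathrm{Tm}(A)\mid r\ t[B]=_{\beta\eta}\mathsf{true}\}$.
   Context: Simple types: $A ::= o \mid A\to B \mid A\times B \mid 1$; $\mathrm{Tm}(A)$ is the set of closed simply typed $\lambda$-terms (with type-annotated abstractions, pairs, projections, unit) of type $A$ modulo $\beta\eta$. For a finite set $Q$, $[\![A]\!]_Q$ is the set-theoretic interpretation: $[\![o]\!]_Q=Q$, $[\![A\to B]\!]_Q$ the set of functions, $[\![A\times B]\!]_Q$ the cartesian product, $[\![1]\!]_Q$ a singleton, and $[\![t]\!]_Q\in[\![A]\!]_Q$ is the standard set-theoretic denotation of $t$. $A[B]$ is $A$ with every occurrence of $o$ replaced by $B$, and $t[B]$ is $t$ with every type annotation $A'$ replaced by $A'[B]$ (so $t[B]\in\mathrm{Tm}(A[B])$). $\mathrm{Bool}:=o\times o\to o$ and $\mathsf{true}:=\lambda(x:o\times o).\,x_1$. *)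

theory Defs
  imports Main "HOL-Library.FSet"
begin

section \<open>Simple types and annotated terms\<close>

datatype ty = Base | Fun ty ty | Prod ty ty | One

text \<open>Terms are in de Bruijn notation; index 0 is the innermost binder.\<close>

datatype tm =
    Var nat
  | Lam ty tm
  | App tm tm
  | Pair tm tm
  | Fst tm
  | Snd tm
  | Unit

inductive typing :: "ty list \<Rightarrow> tm \<Rightarrow> ty \<Rightarrow> bool"  (\<open>(_ \<turnstile> _ : _)\<close> [51, 51, 51] 50) where
  T_Var:  "i < length \<Gamma> \<Longrightarrow> \<Gamma> \<turnstile> Var i : \<Gamma> ! i"
| T_Lam:  "A # \<Gamma> \<turnstile> t : B \<Longrightarrow> \<Gamma> \<turnstile> Lam A t : Fun A B"
| T_App:  "\<Gamma> \<turnstile> t : Fun A B \<Longrightarrow> \<Gamma> \<turnstile> u : A \<Longrightarrow> \<Gamma> \<turnstile> App t u : B"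
| T_Pair: "\<Gamma> \<turnstile> t : A \<Longrightarrow> \<Gamma> \<turnstile> u : B \<Longrightarrow> \<Gamma> \<turnstile> Pair t u : Prod A B"
| T_Fst:  "\<Gamma> \<turnstile> t : Prod A B \<Longrightarrow> \<Gamma> \<turnstile> Fst t : A"
| T_Snd:  "\<Gamma> \<turnstile> t : Prod A B \<Longrightarrow> \<Gamma> \<turnstile> Snd t : B"
| T_Unit: "\<Gamma> \<turnstile> Unit : One"


section \<open>Substitution and \<open>\<beta>\<eta>\<close>-conversion\<close>

definition upr :: "(nat \<Rightarrow> nat) \<Rightarrow> nat \<Rightarrow> nat" where
  "upr f i = (case i of 0 \<Rightarrow> 0 | Suc j \<Rightarrow> Suc (f j))"

primrec ren :: "(nat \<Rightarrow> nat) \<Rightarrow> tm \<Rightarrow> tm" where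
  "ren f (Var i) = Var (f i)"
| "ren f (Lam A t) = Lam A (ren (upr f) t)"
| "ren f (App t u) = App (ren f t) (ren f u)"
| "ren f (Pair t u) = Pair (ren f t) (ren f u)"
| "ren f (Fst t) = Fst (ren f t)"
| "ren f (Snd t) = Snd (ren f t)"
| "ren f Unit = Unit"

definition ups :: "(nat \<Rightarrow> tm) \<Rightarrow> nat \<Rightarrow> tm" where
  "ups \<sigma> i = (case i of 0 \<Rightarrow> Var 0 | Suc j \<Rightarrow> ren Suc (\<sigma> j))"

primrec subst :: "(nat \<Rightarrow> tm) \<Rightarrow> tm \<Rightarrow> tm" where
  "subst \<sigma> (Var i) = \<sigma> i"
| "subst \<sigma> (Lam A t) = Lam A (subst (ups \<sigma>) t)"
| "subst \<sigma> (App t u) = App (subst \<sigma> t) (subst \<sigma> u)"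
| "subst \<sigma> (Pair t u) = Pair (subst \<sigma> t) (subst \<sigma> u)"
| "subst \<sigma> (Fst t) = Fst (subst \<sigma> t)"
| "subst \<sigma> (Snd t) = Snd (subst \<sigma> t)"
| "subst \<sigma> Unit = Unit"

definition inst :: "tm \<Rightarrow> nat \<Rightarrow> tm" where
  "inst s i = (case i of 0 \<Rightarrow> s | Suc j \<Rightarrow> Var j)"

text \<open>The judgement is typed because the \<open>\<eta>\<close>-rule of the unit type depends on the type.\<close>

inductive conv :: "ty list \<Rightarrow> tm \<Rightarrow> tm \<Rightarrow> ty \<Rightarrow> bool"  (\<open>(_ \<turnstile> _ \<approx> _ : _)\<close> [51, 51, 51, 51] 50) where
  C_refl:  "\<Gamma> \<turnstile> t : A \<Longrightarrow> \<Gamma> \<turnstile> t \<approx> t : A"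
| C_sym:   "\<Gamma> \<turnstile> t \<approx> u : A \<Longrightarrow> \<Gamma> \<turnstile> u \<approx> t : A"
| C_trans: "\<Gamma> \<turnstile> t \<approx> u : A \<Longrightarrow> \<Gamma> \<turnstile> u \<approx> v : A \<Longrightarrow> \<Gamma> \<turnstile> t \<approx> v : A"
| C_Lam:   "A # \<Gamma> \<turnstile> t \<approx> t' : B \<Longrightarrow> \<Gamma> \<turnstile> Lam A t \<approx> Lam A t' : Fun A B"
| C_App:   "\<Gamma> \<turnstile> t \<approx> t' : Fun A B \<Longrightarrow> \<Gamma> \<turnstile> u \<approx> u' : A \<Longrightarrow> \<Gamma> \<turnstile> App t u \<approx> App t' u' : B"
| C_Pair:  "\<Gamma> \<turnstile> t \<approx> t' : A \<Longrightarrow> \<Gamma> \<turnstile> u \<approx> u' : B \<Longrightarrow> \<Gamma> \<turnstile> Pair t u \<approx> Pair t' u' : Prod A B"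
| C_Fst:   "\<Gamma> \<turnstile> t \<approx> t' : Prod A B \<Longrightarrow> \<Gamma> \<turnstile> Fst t \<approx> Fst t' : A"
| C_Snd:   "\<Gamma> \<turnstile> t \<approx> t' : Prod A B \<Longrightarrow> \<Gamma> \<turnstile> Snd t \<approx> Snd t' : B"
| C_beta:  "A # \<Gamma> \<turnstile> t : B \<Longrightarrow> \<Gamma> \<turnstile> s : A \<Longrightarrow> \<Gamma> \<turnstile> App (Lam A t) s \<approx> subst (inst s) t : B"
| C_fst:   "\<Gamma> \<turnstile> t : A \<Longrightarrow> \<Gamma> \<turnstile> u : B \<Longrightarrow> \<Gamma> \<turnstile> Fst (Pair t u) \<approx> t : A"
| C_snd:   "\<Gamma> \<turnstile> t : A \<Longrightarrow> \<Gamma> \<turnstile> u : B \<Longrightarrow> \<Gamma> \<turnstile> Snd (Pair t u) \<approx> u : B"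
| C_eta:   "\<Gamma> \<turnstile> t : Fun A B \<Longrightarrow> \<Gamma> \<turnstile> Lam A (App (ren Suc t) (Var 0)) \<approx> t : Fun A B"
| C_pair:  "\<Gamma> \<turnstile> t : Prod A B \<Longrightarrow> \<Gamma> \<turnstile> Pair (Fst t) (Snd t) \<approx> t : Prod A B"
| C_unit:  "\<Gamma> \<turnstile> t : One \<Longrightarrow> \<Gamma> \<turnstile> t \<approx> Unit : One"


section \<open>Replacing the base type\<close>

primrec ty_at :: "ty \<Rightarrow> ty \<Rightarrow> ty" where
  "ty_at Base B = B"
| "ty_at (Fun A A') B = Fun (ty_at A B) (ty_at A' B)"
| "ty_at (Prod A A') B = Prod (ty_at A B) (ty_at A' B)"
| "ty_at One B = One"

primrec tm_at :: "tm \<Rightarrow> ty \<Rightarrow> tm" where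
  "tm_at (Var i) B = Var i"
| "tm_at (Lam A t) B = Lam (ty_at A B) (tm_at t B)"
| "tm_at (App t u) B = App (tm_at t B) (tm_at u B)"
| "tm_at (Pair t u) B = Pair (tm_at t B) (tm_at u B)"
| "tm_at (Fst t) B = Fst (tm_at t B)"
| "tm_at (Snd t) B = Snd (tm_at t B)"
| "tm_at Unit B = Unit"


section \<open>Set-theoretic semantics\<close>

text \<open>
  A single type of values accommodates the interpretations of all simple types over a finite
  set: functions are represented by their graphs, which are then finite.
\<close>

datatype 'q val =
    VBase 'q
  | VFun "('q val \<times> 'q val) fset"
  | VPair "'q val" "'q val"
  | VUnit

primrec interp :: "'q set \<Rightarrow> ty \<Rightarrow> 'q val set" where
  "interp Q Base = VBase ` Q"
| "interp Q (Fun A B) =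
    {VFun g | g. fset g \<subseteq> interp Q A \<times> interp Q B \<and> (\<forall>a \<in> interp Q A. \<exists>!b. (a, b) \<in> fset g)}"
| "interp Q (Prod A B) = {VPair a b | a b. a \<in> interp Q A \<and> b \<in> interp Q B}"
| "interp Q One = {VUnit}"

fun vapp :: "'q val \<Rightarrow> 'q val \<Rightarrow> 'q val" where
  "vapp (VFun g) a = (THE b. (a, b) \<in> fset g)"

fun vfst :: "'q val \<Rightarrow> 'q val" where
  "vfst (VPair a b) = a"

fun vsnd :: "'q val \<Rightarrow> 'q val" where
  "vsnd (VPair a b) = b"

primrec den :: "'q set \<Rightarrow> 'q val list \<Rightarrow> tm \<Rightarrow> 'q val" where
  "den Q \<rho> (Var i) = \<rho> ! i"
| "den Q \<rho> (Lam A t) = VFun (Abs_fset ((\<lambda>a. (a, den Q (a # \<rho>) t)) ` interp Q A))"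
| "den Q \<rho> (App t u) = vapp (den Q \<rho> t) (den Q \<rho> u)"
| "den Q \<rho> (Pair t u) = VPair (den Q \<rho> t) (den Q \<rho> u)"
| "den Q \<rho> (Fst t) = vfst (den Q \<rho> t)"
| "den Q \<rho> (Snd t) = vsnd (den Q \<rho> t)"
| "den Q \<rho> Unit = VUnit"


section \<open>Closed terms modulo \<open>\<beta>\<eta>\<close>\<close>

text \<open>By uniqueness of types, the type in the definition of \<open>beq\<close> is determined by either term.\<close>

definition beq :: "(tm \<times> tm) set" where
  "beq = {(t, u). \<exists>A. [] \<turnstile> t \<approx> u : A}"

abbreviation cls :: "tm \<Rightarrow> tm set" where
  "cls t \<equiv> beq `` {t}"

definition Tm :: "ty \<Rightarrow> tm set set" where
  "Tm A = {t. [] \<turnstile> t : A} // beq"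

text \<open>
  The operations on terms are lifted to classes through representatives; the lemmas
  \<open>cden_cls\<close>, \<open>ctm_at_cls\<close> and \<open>capp_cls\<close> below show that the choice does not matter.
\<close>

definition cden :: "'q set \<Rightarrow> tm set \<Rightarrow> 'q val" where
  "cden Q c = the_elem (\<Union>t\<in>c. {den Q [] t})"

definition ctm_at :: "tm set \<Rightarrow> ty \<Rightarrow> tm set" where
  "ctm_at c B = (\<Union>t\<in>c. cls (tm_at t B))"

definition capp :: "tm set \<Rightarrow> tm set \<Rightarrow> tm set" where
  "capp c d = (\<Union>t\<in>c. \<Union>u\<in>d. cls (App t u))"

definition Bool_ty :: ty where
  "Bool_ty = Fun (Prod Base Base) Base"

definition true_tm :: "tm set" where
  "true_tm = cls (Lam (Prod Base Base) (Fst (Var 0)))"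


section \<open>Well-definedness\<close>

inductive_cases typingE:
  "\<Gamma> \<turnstile> Var i : A" "\<Gamma> \<turnstile> Lam C t : A" "\<Gamma> \<turnstile> App t u : A" "\<Gamma> \<turnstile> Pair t u : A"
  "\<Gamma> \<turnstile> Fst t : A" "\<Gamma> \<turnstile> Snd t : A" "\<Gamma> \<turnstile> Unit : A"

lemma typing_unique: "\<Gamma> \<turnstile> t : A \<Longrightarrow> \<Gamma> \<turnstile> t : B \<Longrightarrow> A = B"
  by (induction arbitrary: B rule: typing.induct) (blast elim: typingE)+

lemma typing_ren:
  "\<Gamma> \<turnstile> t : A \<Longrightarrow> (\<And>i. i < length \<Gamma> \<Longrightarrow> f i < length \<Delta> \<and> \<Delta> ! f i = \<Gamma> ! i) \<Longrightarrow> \<Delta> \<turnstile> ren f t : A"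
proof (induction arbitrary: f \<Delta> rule: typing.induct)
  case (T_Var i \<Gamma>)
  then show ?case by (metis ren.simps(1) typing.T_Var)
next
  case (T_Lam A \<Gamma> t B)
  have "A # \<Delta> \<turnstile> ren (upr f) t : B"
    by (rule T_Lam.IH) (auto simp: upr_def T_Lam.prems split: nat.split)
  then show ?case by (simp add: typing.T_Lam)
next
  case (T_App \<Gamma> t A B u)
  from T_App.IH[OF T_App.prems] show ?case by (auto intro: typing.T_App)
qed (auto intro: typing.intros)

lemma typing_subst:
  "\<Gamma> \<turnstile> t : A \<Longrightarrow> (\<And>i. i < length \<Gamma> \<Longrightarrow> \<Delta> \<turnstile> \<sigma> i : \<Gamma> ! i) \<Longrightarrow> \<Delta> \<turnstile> subst \<sigma> t : A"
proof (induction arbitrary: \<sigma> \<Delta> rule: typing.induct)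
  case (T_Lam A \<Gamma> t B)
  have "A # \<Delta> \<turnstile> subst (ups \<sigma>) t : B"
  proof (rule T_Lam.IH)
    fix i assume i: "i < length (A # \<Gamma>)"
    show "A # \<Delta> \<turnstile> ups \<sigma> i : (A # \<Gamma>) ! i"
    proof (cases i)
      case 0
      then show ?thesis using T_Var[of 0 "A # \<Delta>"] by (simp add: ups_def)
    next
      case (Suc j)
      then show ?thesis using i by (auto simp: ups_def intro!: typing_ren T_Lam.prems)
    qed
  qed
  then show ?case by (simp add: typing.T_Lam)
next
  case (T_App \<Gamma> t A B u)
  from T_App.IH[OF T_App.prems] show ?case by (auto intro: typing.T_App)
qed (auto intro: typing.intros)

lemma typing_inst:
  assumes "A # \<Gamma> \<turnstile> t : B" "\<Gamma> \<turnstile> s : A"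
  shows "\<Gamma> \<turnstile> subst (inst s) t : B"
  using assms(1) by (rule typing_subst) (auto simp: inst_def assms(2) T_Var split: nat.split)

lemma typing_shift: "\<Gamma> \<turnstile> t : A \<Longrightarrow> B # \<Gamma> \<turnstile> ren Suc t : A"
  by (erule typing_ren) simp

lemma conv_typing: "\<Gamma> \<turnstile> t \<approx> u : A \<Longrightarrow> \<Gamma> \<turnstile> t : A \<and> \<Gamma> \<turnstile> u : A"
proof (induction rule: conv.induct)
  case (C_beta A \<Gamma> t B s)
  then show ?case by (auto intro: typing.intros typing_inst)
next
  case (C_eta \<Gamma> t A B)
  have "A # \<Gamma> \<turnstile> Var 0 : A" using T_Var[of 0 "A # \<Gamma>"] by simp
  with C_eta show ?case by (auto intro: typing.intros typing_shift)
qed (auto intro: typing.intros)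

lemma equiv_beq: "equiv {t. \<exists>A. [] \<turnstile> t : A} beq"
proof (rule equivI)
  show "refl_on {t. \<exists>A. [] \<turnstile> t : A} beq"
    by (auto simp: refl_on_def beq_def intro: C_refl dest: conv_typing)
  show "beq \<subseteq> {t. \<exists>A. [] \<turnstile> t : A} \<times> {t. \<exists>A. [] \<turnstile> t : A}"
    by (auto simp: beq_def dest: conv_typing)
  show "sym beq" by (auto simp: sym_def beq_def intro: C_sym)
  show "trans beq"
    unfolding trans_def beq_def by (auto) (metis C_trans conv_typing typing_unique)
qed

lemma cls_eq_iff:
  assumes "[] \<turnstile> t : A"
  shows "cls t = cls u \<longleftrightarrow> [] \<turnstile> t \<approx> u : A"
proof
  assume "cls t = cls u"
  moreover have "(t, t) \<in> beq" using assms by (auto simp: beq_def intro: C_refl)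
  ultimately have "(u, t) \<in> beq" by auto
  then show "[] \<turnstile> t \<approx> u : A"
    using assms unfolding beq_def by (auto) (metis C_sym conv_typing typing_unique)
next
  assume "[] \<turnstile> t \<approx> u : A"
  then have "(t, u) \<in> beq" by (auto simp: beq_def)
  then show "cls t = cls u" by (rule equiv_class_eq[OF equiv_beq])
qed

lemma in_cls_iff:
  assumes "[] \<turnstile> t : A"
  shows "u \<in> cls t \<longleftrightarrow> [] \<turnstile> t \<approx> u : A"
  using assms unfolding beq_def by (auto) (metis conv_typing typing_unique)

lemma self_in_cls: "[] \<turnstile> t : A \<Longrightarrow> t \<in> cls t"
  by (auto simp: beq_def intro: C_refl)

lemma Tm_iff: "c \<in> Tm A \<longleftrightarrow> (\<exists>t. [] \<turnstile> t : A \<and> c = cls t)"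
  by (auto simp: Tm_def quotient_def)

lemma typing_tm_at: "\<Gamma> \<turnstile> t : A \<Longrightarrow> map (\<lambda>A. ty_at A B) \<Gamma> \<turnstile> tm_at t B : ty_at A B"
proof (induction rule: typing.induct)
  case (T_Var i \<Gamma>)
  then show ?case using typing.T_Var[of i "map (\<lambda>A. ty_at A B) \<Gamma>"] by simp
qed (auto intro: typing.intros)

lemma tm_at_ren: "tm_at (ren f t) B = ren f (tm_at t B)"
  by (induction t arbitrary: f) auto

lemma tm_at_subst: "tm_at (subst \<sigma> t) B = subst (\<lambda>i. tm_at (\<sigma> i) B) (tm_at t B)"
proof (induction t arbitrary: \<sigma>)
  case (Lam A t)
  have "(\<lambda>i. tm_at (ups \<sigma> i) B) = ups (\<lambda>i. tm_at (\<sigma> i) B)"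
    by (auto simp: ups_def tm_at_ren split: nat.split)
  then show ?case by (simp add: Lam)
qed auto

lemma conv_tm_at:
  "\<Gamma> \<turnstile> t \<approx> u : A \<Longrightarrow> map (\<lambda>A. ty_at A B) \<Gamma> \<turnstile> tm_at t B \<approx> tm_at u B : ty_at A B"
proof (induction rule: conv.induct)
  case (C_beta A \<Gamma> t C s)
  have "(\<lambda>i. tm_at (inst s i) B) = inst (tm_at s B)"
    by (auto simp: inst_def split: nat.split)
  then show ?case
    using C_beta[THEN typing_tm_at] by (auto simp: tm_at_subst intro!: conv.C_beta)
next
  case (C_eta \<Gamma> t A C)
  then show ?case
    using typing_tm_at[OF C_eta, of B] by (auto simp: tm_at_ren intro!: conv.C_eta)
next
  case (C_trans \<Gamma> t u A v)
  then show ?case by (blast intro: conv.C_trans)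
next
  case (C_sym \<Gamma> t u A)
  then show ?case by (blast intro: conv.C_sym)
next
  case (C_pair \<Gamma> t A C)
  then show ?case using typing_tm_at[OF C_pair, of B] by (auto intro: conv.C_pair)
next
  case (C_unit \<Gamma> t)
  then show ?case using typing_tm_at[OF C_unit, of B] by (auto intro: conv.C_unit)
qed (auto intro: conv.intros dest: typing_tm_at[where B = B])

lemma finite_interp: "finite Q \<Longrightarrow> finite (interp Q A)"
proof (induction A)
  case (Fun A B)
  have "interp Q (Fun A B) \<subseteq> VFun ` Abs_fset ` Pow (interp Q A \<times> interp Q B)"
  proof
    fix x assume "x \<in> interp Q (Fun A B)"
    then obtain g where g: "x = VFun g" "fset g \<subseteq> interp Q A \<times> interp Q B" by auto
    then have "x = VFun (Abs_fset (fset g))" by (simp add: fset_inverse)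
    with g show "x \<in> VFun ` Abs_fset ` Pow (interp Q A \<times> interp Q B)" by blast
  qed
  with Fun show ?case by (meson finite_Pow_iff finite_SigmaI finite_imageI finite_subset)
next
  case (Prod A B)
  have "interp Q (Prod A B) = (\<lambda>(a, b). VPair a b) ` (interp Q A \<times> interp Q B)" by auto
  with Prod show ?case by (simp only:) (intro finite_imageI finite_cartesian_product; blast)
qed auto

lemma fset_graph:
  "finite Q \<Longrightarrow> fset (Abs_fset ((\<lambda>a. (a, h a)) ` interp Q A)) = (\<lambda>a. (a, h a)) ` interp Q A"
  by (rule Abs_fset_inverse) (simp add: finite_interp)

lemma vapp_graph:
  "finite Q \<Longrightarrow> a \<in> interp Q A \<Longrightarrow> vapp (VFun (Abs_fset ((\<lambda>a. (a, h a)) ` interp Q A))) a = h a"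
  by (auto simp: fset_graph)

lemma vapp_in_interp:
  assumes "f \<in> interp Q (Fun A B)" "a \<in> interp Q A"
  shows "vapp f a \<in> interp Q B"
proof -
  obtain g where g: "f = VFun g" "fset g \<subseteq> interp Q A \<times> interp Q B"
    "\<exists>!b. (a, b) \<in> fset g" using assms by auto
  from theI'[OF g(3)] g(1,2) show ?thesis by auto
qed

lemma graph_vapp:
  assumes "f \<in> interp Q (Fun A B)"
  shows "VFun (Abs_fset ((\<lambda>a. (a, vapp f a)) ` interp Q A)) = f"
proof -
  obtain g where g: "f = VFun g" "fset g \<subseteq> interp Q A \<times> interp Q B"
    "\<And>a. a \<in> interp Q A \<Longrightarrow> \<exists>!b. (a, b) \<in> fset g" using assms by auto
  have "(\<lambda>a. (a, vapp f a)) ` interp Q A = fset g"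
  proof (intro equalityI subsetI)
    fix p assume "p \<in> (\<lambda>a. (a, vapp f a)) ` interp Q A"
    then obtain a where a: "a \<in> interp Q A" "p = (a, vapp f a)" by auto
    from theI'[OF g(3)[OF a(1)]] a(2) g(1) show "p \<in> fset g" by simp
  next
    fix p assume p: "p \<in> fset g"
    then obtain a b where ab: "p = (a, b)" "a \<in> interp Q A" using g(2) by auto
    have "(THE b. (a, b) \<in> fset g) = b"
      using g(3)[OF ab(2)] p ab(1) by (blast intro: the1_equality)
    with ab g(1) show "p \<in> (\<lambda>a. (a, vapp f a)) ` interp Q A" by auto
  qed
  then show ?thesis using g(1) by (simp add: fset_inverse)
qed

lemma den_in_interp:
  assumes "finite Q"
  shows "\<Gamma> \<turnstile> t : A \<Longrightarrow> list_all2 (\<lambda>v A. v \<in> interp Q A) \<rho> \<Gamma> \<Longrightarrow> den Q \<rho> t \<in> interp Q A"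
proof (induction arbitrary: \<rho> rule: typing.induct)
  case (T_Var i \<Gamma>)
  then show ?case by (simp add: list_all2_conv_all_nth)
next
  case (T_Lam A \<Gamma> t B)
  have "den Q (a # \<rho>) t \<in> interp Q B" if "a \<in> interp Q A" for a
    using T_Lam that by simp
  then show ?case by (auto simp: fset_graph[OF assms])
next
  case (T_App \<Gamma> t A B u)
  then show ?case by (simp only: den.simps) (blast intro: vapp_in_interp)
next
  case (T_Fst \<Gamma> t A B)
  from T_Fst.IH[OF T_Fst.prems] show ?case by auto
next
  case (T_Snd \<Gamma> t A B)
  from T_Snd.IH[OF T_Snd.prems] show ?case by auto
qed auto

lemma den_ren:
  "\<Gamma> \<turnstile> t : A \<Longrightarrow> (\<And>i. i < length \<Gamma> \<Longrightarrow> \<rho>' ! f i = \<rho> ! i) \<Longrightarrow> den Q \<rho>' (ren f t) = den Q \<rho> t"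
proof (induction arbitrary: f \<rho> \<rho>' rule: typing.induct)
  case (T_Lam A \<Gamma> t B)
  have "den Q (a # \<rho>') (ren (upr f) t) = den Q (a # \<rho>) t" for a
    by (rule T_Lam.IH) (auto simp: upr_def T_Lam.prems split: nat.split)
  then show ?case by simp
next
  case (T_App \<Gamma> t A B u)
  from T_App.IH[OF T_App.prems] show ?case by simp
next
  case (T_Pair \<Gamma> t A u B)
  from T_Pair.IH[OF T_Pair.prems] show ?case by simp
next
  case (T_Fst \<Gamma> t A B)
  from T_Fst.IH[OF T_Fst.prems] show ?case by simp
next
  case (T_Snd \<Gamma> t A B)
  from T_Snd.IH[OF T_Snd.prems] show ?case by simp
qed auto

lemma den_subst:
  "\<Gamma> \<turnstile> t : A \<Longrightarrow> (\<And>i. i < length \<Gamma> \<Longrightarrow> \<Delta> \<turnstile> \<sigma> i : \<Gamma> ! i \<and> den Q \<rho>' (\<sigma> i) = \<rho> ! i)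
    \<Longrightarrow> den Q \<rho>' (subst \<sigma> t) = den Q \<rho> t"
proof (induction arbitrary: \<sigma> \<Delta> \<rho> \<rho>' rule: typing.induct)
  case (T_Lam A \<Gamma> t B)
  have "den Q (a # \<rho>') (subst (ups \<sigma>) t) = den Q (a # \<rho>) t" for a
  proof (rule T_Lam.IH[where \<Delta> = "A # \<Delta>"])
    fix i assume i: "i < length (A # \<Gamma>)"
    show "A # \<Delta> \<turnstile> ups \<sigma> i : (A # \<Gamma>) ! i \<and> den Q (a # \<rho>') (ups \<sigma> i) = (a # \<rho>) ! i"
    proof (cases i)
      case 0
      then show ?thesis using T_Var[of 0 "A # \<Delta>"] by (simp add: ups_def)
    next
      case (Suc j)
      with i T_Lam.prems[of j] have j: "\<Delta> \<turnstile> \<sigma> j : \<Gamma> ! j" "den Q \<rho>' (\<sigma> j) = \<rho> ! j" by auto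
      have "den Q (a # \<rho>') (ren Suc (\<sigma> j)) = den Q \<rho>' (\<sigma> j)"
        by (rule den_ren[OF j(1)]) simp
      then show ?thesis using Suc j by (simp add: ups_def typing_shift)
    qed
  qed
  then show ?case by simp
next
  case (T_App \<Gamma> t A B u)
  from T_App.IH[OF T_App.prems] show ?case by simp
next
  case (T_Pair \<Gamma> t A u B)
  from T_Pair.IH[OF T_Pair.prems] show ?case by simp
next
  case (T_Fst \<Gamma> t A B)
  from T_Fst.IH[OF T_Fst.prems] show ?case by simp
next
  case (T_Snd \<Gamma> t A B)
  from T_Snd.IH[OF T_Snd.prems] show ?case by simp
qed auto

lemma den_conv:
  assumes "finite Q"
  shows "\<Gamma> \<turnstile> t \<approx> u : A \<Longrightarrow> list_all2 (\<lambda>v A. v \<in> interp Q A) \<rho> \<Gamma> \<Longrightarrow> den Q \<rho> t = den Q \<rho> u"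
proof (induction arbitrary: \<rho> rule: conv.induct)
  case (C_Lam A \<Gamma> t t' B)
  have "den Q (a # \<rho>) t = den Q (a # \<rho>) t'" if "a \<in> interp Q A" for a
    using C_Lam that by simp
  then have "(\<lambda>a. (a, den Q (a # \<rho>) t)) ` interp Q A = (\<lambda>a. (a, den Q (a # \<rho>) t')) ` interp Q A"
    by (intro image_cong) auto
  then show ?case by simp
next
  case (C_App \<Gamma> t t' A B u u')
  from C_App.IH[OF C_App.prems] show ?case by simp
next
  case (C_beta A \<Gamma> t B s)
  have s: "den Q \<rho> s \<in> interp Q A" by (rule den_in_interp[OF assms C_beta(2,3)])
  have "den Q \<rho> (subst (inst s) t) = den Q (den Q \<rho> s # \<rho>) t"
    by (rule den_subst[OF C_beta(1), where \<Delta> = \<Gamma>])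
      (auto simp: inst_def C_beta(2) T_Var split: nat.split)
  then show ?case using s by (simp add: vapp_graph[OF assms] del: vapp.simps)
next
  case (C_eta \<Gamma> t A B)
  have t: "den Q \<rho> t \<in> interp Q (Fun A B)" by (rule den_in_interp[OF assms C_eta])
  have "den Q (a # \<rho>) (ren Suc t) = den Q \<rho> t" for a
    by (rule den_ren[OF C_eta(1)]) simp
  then show ?case using graph_vapp[OF t] by simp
next
  case (C_pair \<Gamma> t A B)
  from den_in_interp[OF assms C_pair] show ?case by auto
next
  case (C_unit \<Gamma> t)
  from den_in_interp[OF assms C_unit] show ?case by auto
qed auto

lemma cden_cls:
  assumes "finite Q" "[] \<turnstile> t : A"
  shows "cden Q (cls t) = den Q [] t"
proof -
  have "den Q [] u = den Q [] t" if "u \<in> cls t" for u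
    using that in_cls_iff[OF assms(2)] den_conv[OF assms(1), of "[]" t u A "[]"] by simp
  moreover have "t \<in> cls t" by (rule self_in_cls[OF assms(2)])
  ultimately have "(\<Union>u\<in>cls t. {den Q [] u}) = {den Q [] t}" by blast
  then show ?thesis by (simp only: cden_def the_elem_eq)
qed

lemma ctm_at_cls:
  assumes "[] \<turnstile> t : A"
  shows "ctm_at (cls t) B = cls (tm_at t B)"
proof -
  have "cls (tm_at u B) = cls (tm_at t B)" if "u \<in> cls t" for u
  proof -
    have "[] \<turnstile> tm_at t B \<approx> tm_at u B : ty_at A B"
      using that in_cls_iff[OF assms] conv_tm_at[of "[]" t u A B] by simp
    then show ?thesis using cls_eq_iff conv_typing by metis
  qed
  with self_in_cls[OF assms] show ?thesis unfolding ctm_at_def by blast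
qed

lemma capp_cls:
  assumes "[] \<turnstile> t : Fun A B" "[] \<turnstile> u : A"
  shows "capp (cls t) (cls u) = cls (App t u)"
proof -
  have "cls (App t' u') = cls (App t u)" if "t' \<in> cls t" "u' \<in> cls u" for t' u'
  proof -
    have "[] \<turnstile> App t u \<approx> App t' u' : B"
      using that in_cls_iff[OF assms(1)] in_cls_iff[OF assms(2)] by (blast intro: C_App)
    then show ?thesis using cls_eq_iff conv_typing by metis
  qed
  with self_in_cls[OF assms(1)] self_in_cls[OF assms(2)] show ?thesis
    unfolding capp_def by blast
qed

lemma cden_in_interp: "finite Q \<Longrightarrow> c \<in> Tm A \<Longrightarrow> cden Q c \<in> interp Q A"
  by (auto simp: Tm_iff cden_cls intro: den_in_interp)

lemma ctm_at_in_Tm: "c \<in> Tm A \<Longrightarrow> ctm_at c B \<in> Tm (ty_at A B)"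
  using typing_tm_at[of "[]" _ A B] ctm_at_cls unfolding Tm_iff by (metis list.map(1))

lemma capp_in_Tm: "c \<in> Tm (Fun A B) \<Longrightarrow> d \<in> Tm A \<Longrightarrow> capp c d \<in> Tm B"
  by (auto simp: Tm_iff capp_cls intro: T_App)

lemma true_in_Tm: "true_tm \<in> Tm Bool_ty"
proof -
  have "[Prod Base Base] \<turnstile> Var 0 : Prod Base Base"
    using T_Var[of 0 "[Prod Base Base]"] by simp
  then have "[] \<turnstile> Lam (Prod Base Base) (Fst (Var 0)) : Bool_ty"
    unfolding Bool_ty_def by (intro typing.intros)
  then show ?thesis by (auto simp: Tm_iff true_tm_def)
qed

end

theory Submission
  imports Defs
begin

text \<open>
  Take for \<open>B\<close> a power of \<open>Bool\<close>, in which the elements of \<open>Q\<close> have a one-hot encoding. A logical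
  relation between \<open>[[A]]\<^sub>Q\<close> and the closed terms of type \<open>A[B]\<close>, which is the encoding at the base
  type, relates the denotation of every closed term \<open>t\<close> to \<open>t[B]\<close>. By induction on \<open>A\<close>, every
  element \<open>d\<close> of \<open>[[A]]\<^sub>Q\<close> is related to some closed term, and some closed term of type
  \<open>A[B] \<rightarrow> Bool\<close> decides whether its argument is related to \<open>d\<close>: a function is represented by a
  case distinction over the tests for its arguments, and is tested by evaluating it at the
  representatives of all its arguments. Conditionals at every simple type come from \<open>Bool\<close> by
  \<open>\<eta>\<close>-expansion. The disjunction of the tests for the elements of \<open>F\<close> recognizes the language.
\<close>

section \<open>Substitution\<close>

lemma ren_ren: "ren g (ren f t) = ren (\<lambda>i. g (f i)) t"
proof (induction t arbitrary: f g)
  case (Lam A t)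
  have "(\<lambda>i. upr g (upr f i)) = upr (\<lambda>i. g (f i))"
    by (auto simp: upr_def split: nat.split)
  then show ?case by (simp add: Lam)
qed auto

lemma subst_ren: "subst \<tau> (ren f t) = subst (\<lambda>i. \<tau> (f i)) t"
proof (induction t arbitrary: f \<tau>)
  case (Lam A t)
  have "(\<lambda>i. ups \<tau> (upr f i)) = ups (\<lambda>i. \<tau> (f i))"
    by (auto simp: ups_def upr_def split: nat.split)
  then show ?case by (simp add: Lam)
qed auto

lemma ren_subst: "ren f (subst \<sigma> t) = subst (\<lambda>i. ren f (\<sigma> i)) t"
proof (induction t arbitrary: f \<sigma>)
  case (Lam A t)
  have "(\<lambda>i. ren (upr f) (ups \<sigma> i)) = ups (\<lambda>i. ren f (\<sigma> i))"
    by (auto simp: ups_def upr_def ren_ren split: nat.split)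
  then show ?case by (simp add: Lam)
qed auto

lemma subst_ups_shift: "subst (ups \<sigma>) (ren Suc t) = ren Suc (subst \<sigma> t)"
  by (simp add: subst_ren ren_subst ups_def)

text \<open>Under a binder, the composite of two lifts has to be the lift of the composite. At
  successor indices this is \<open>subst_ups_shift\<close>, which rests on the mixed laws for
  renaming and substitution.\<close>

lemma subst_subst: "subst \<tau> (subst \<sigma> t) = subst (\<lambda>i. subst \<tau> (\<sigma> i)) t"
proof (induction t arbitrary: \<sigma> \<tau>)
  case (Lam A t)
  have "(\<lambda>i. subst (ups \<tau>) (ups \<sigma> i)) = ups (\<lambda>i. subst \<tau> (\<sigma> i))"
    \<comment> \<open>The lift of \<open>\<tau>\<close> is unfolded only at index 0, so that
      \<open>subst_ups_shift\<close> still matches at successor indices.\<close>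
    by (auto simp: ups_def[of \<sigma>] ups_def[of "\<lambda>i. subst \<tau> (\<sigma> i)"] ups_def[of \<tau> 0]
        subst_ups_shift split: nat.split)
  then show ?case by (simp add: Lam)
qed auto

section \<open>Closed terms and weakening\<close>

text \<open>Typing bounds the free indices by the length of the context, so values of
  \<open>\<sigma>\<close> beyond it are never consulted. For the empty context, every substitution
  fixes the term.\<close>

lemma subst_typed_id: "\<Gamma> \<turnstile> t : A \<Longrightarrow> (\<And>i. i < length \<Gamma> \<Longrightarrow> \<sigma> i = Var i) \<Longrightarrow> subst \<sigma> t = t"
proof (induction arbitrary: \<sigma> rule: typing.induct)
  case (T_Lam A \<Gamma> t B)
  have "subst (ups \<sigma>) t = t"
    by (rule T_Lam.IH) (auto simp: ups_def T_Lam.prems split: nat.split)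
  then show ?case by simp
qed auto

lemma ren_typed_id: "\<Gamma> \<turnstile> t : A \<Longrightarrow> (\<And>i. i < length \<Gamma> \<Longrightarrow> f i = i) \<Longrightarrow> ren f t = t"
proof (induction arbitrary: f rule: typing.induct)
  case (T_Lam A \<Gamma> t B)
  have "ren (upr f) t = t"
    by (rule T_Lam.IH) (auto simp: upr_def T_Lam.prems split: nat.split)
  then show ?case by simp
qed auto

lemma subst_closed: "[] \<turnstile> t : A \<Longrightarrow> subst \<sigma> t = t"
  by (erule subst_typed_id) simp

lemma ren_closed: "[] \<turnstile> t : A \<Longrightarrow> ren f t = t"
  by (erule ren_typed_id) simp

text \<open>The new hypotheses enter at the outer end of the context, where they disturb no de
  Bruijn index; hence \<open>t\<close> needs no renaming.\<close>

lemma typing_weaken: "\<Gamma> \<turnstile> t : A \<Longrightarrow> \<Gamma> @ \<Delta> \<turnstile> t : A"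
proof (induction rule: typing.induct)
  case (T_Var i \<Gamma>)
  then show ?case using typing.T_Var[of i "\<Gamma> @ \<Delta>"] by (simp add: nth_append)
qed (auto intro: typing.intros)

lemma conv_weaken: "\<Gamma> \<turnstile> t \<approx> u : A \<Longrightarrow> \<Gamma> @ \<Delta> \<turnstile> t \<approx> u : A"
proof (induction rule: conv.induct)
  case (C_sym \<Gamma> t u A)
  then show ?case by (blast intro: conv.C_sym)
next
  case (C_trans \<Gamma> t u A v)
  then show ?case by (blast intro: conv.C_trans)
next
  case (C_beta A \<Gamma> t B s)
  then show ?case
    using typing_weaken[of "A # \<Gamma>" t B \<Delta>] typing_weaken[of \<Gamma> s A \<Delta>] by (auto intro: conv.C_beta)
qed (auto intro: C_refl C_Lam C_App C_Pair C_Fst C_Snd C_fst C_snd C_eta C_pair C_unit typing_weaken)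

lemma typing_closed: "[] \<turnstile> t : A \<Longrightarrow> \<Gamma> \<turnstile> t : A"
  using typing_weaken[of "[]" t A \<Gamma>] by simp

lemma conv_closed: "[] \<turnstile> t \<approx> u : A \<Longrightarrow> \<Gamma> \<turnstile> t \<approx> u : A"
  using conv_weaken[of "[]" t u A \<Gamma>] by simp

lemma typing_Var0: "A # \<Gamma> \<turnstile> Var 0 : A"
  using T_Var[of 0 "A # \<Gamma>"] by simp

section \<open>Booleans and conditionals\<close>

text \<open>\<open>true_tm\<close> is the class of \<open>bool_tm True\<close>. Indexing by a HOL
  boolean lets a test be specified by a proposition, as in \<open>bool_tm (p = q)\<close>.\<close>

definition bool_tm :: "bool \<Rightarrow> tm" where
  "bool_tm k = Lam (Prod Base Base) (if k then Fst (Var 0) else Snd (Var 0))"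

lemma typing_bool: "\<Gamma> \<turnstile> bool_tm k : Bool_ty"
  by (auto simp: bool_tm_def Bool_ty_def intro!: T_Lam intro: T_Fst T_Snd typing_Var0)

lemma bool_tm_app:
  assumes "\<Gamma> \<turnstile> x : Base" "\<Gamma> \<turnstile> y : Base"
  shows "\<Gamma> \<turnstile> App (bool_tm k) (Pair x y) \<approx> (if k then x else y) : Base"
proof -
  have "\<Gamma> \<turnstile> App (bool_tm k) (Pair x y) \<approx>
      subst (inst (Pair x y)) (if k then Fst (Var 0) else Snd (Var 0)) : Base"
    unfolding bool_tm_def
    by (rule C_beta) (auto intro: T_Fst T_Snd typing_Var0 T_Pair assms)
  also have "subst (inst (Pair x y)) (if k then Fst (Var 0) else Snd (Var 0)) =
      (if k then Fst (Pair x y) else Snd (Pair x y))"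
    by (simp add: inst_def)
  finally show ?thesis
    by (rule C_trans) (auto intro: C_fst C_snd assms)
qed

text \<open>Conversion is sound in the model over a two-element set, and there the two projections
  are told apart by the pair of True and False.\<close>

lemma bool_tm_inject:
  assumes "[] \<turnstile> bool_tm k \<approx> bool_tm l : Bool_ty"
  shows "k = l"
proof -
  let ?Q = "UNIV :: bool set"
  let ?v = "VPair (VBase True) (VBase False)"
  have "den ?Q [] (bool_tm k) = den ?Q [] (bool_tm l)"
    by (rule den_conv[OF _ assms]) auto
  moreover have "vapp (den ?Q [] (bool_tm j)) ?v = VBase j" for j
    unfolding bool_tm_def den.simps by (subst vapp_graph) auto
  ultimately show ?thesis by (metis val.inject(1))
qed

text \<open>\<open>Bool_ty\<close> eliminates only into \<open>Base\<close>, so at other types the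
  choice is pushed inwards through abstractions and pairs until it reaches \<open>Base\<close> or
  \<open>One\<close>.\<close>

primrec ite :: "ty \<Rightarrow> tm \<Rightarrow> tm \<Rightarrow> tm \<Rightarrow> tm" where
  "ite Base b x y = App b (Pair x y)"
| "ite (Fun A C) b x y =
    Lam A (ite C (ren Suc b) (App (ren Suc x) (Var 0)) (App (ren Suc y) (Var 0)))"
| "ite (Prod A C) b x y = Pair (ite A b (Fst x) (Fst y)) (ite C b (Snd x) (Snd y))"
| "ite One b x y = Unit"

lemma typing_ite: "\<Gamma> \<turnstile> b : Bool_ty \<Longrightarrow> \<Gamma> \<turnstile> x : C \<Longrightarrow> \<Gamma> \<turnstile> y : C \<Longrightarrow> \<Gamma> \<turnstile> ite C b x y : C"
proof (induction C arbitrary: \<Gamma> b x y)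
  case Base
  then show ?case by (auto simp: Bool_ty_def intro: typing.intros)
next
  case (Fun A C)
  have "A # \<Gamma> \<turnstile> ite C (ren Suc b) (App (ren Suc x) (Var 0)) (App (ren Suc y) (Var 0)) : C"
    by (intro Fun.IH(2) T_App[OF typing_shift typing_Var0] typing_shift Fun.prems)
  then show ?case by (auto intro: T_Lam)
next
  case (Prod A C)
  then show ?case by (auto intro!: T_Pair Prod.IH intro: T_Fst T_Snd)
next
  case One
  then show ?case by (auto intro: T_Unit)
qed

lemma subst_ite: "subst \<sigma> (ite C b x y) = ite C (subst \<sigma> b) (subst \<sigma> x) (subst \<sigma> y)"
proof (induction C arbitrary: \<sigma> b x y)
  case (Fun A C)
  have "ups \<sigma> 0 = Var 0" by (simp add: ups_def)
  then show ?case by (simp add: Fun.IH subst_ups_shift)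
qed auto

text \<open>Once the choice is resolved at the smaller types, what remains is an eta-expansion of
  the chosen branch, which the eta rules for functions, pairs and unit contract.\<close>

lemma ite_conv:
  assumes b: "[] \<turnstile> b \<approx> bool_tm k : Bool_ty"
  shows "\<Gamma> \<turnstile> x : C \<Longrightarrow> \<Gamma> \<turnstile> y : C \<Longrightarrow> \<Gamma> \<turnstile> ite C b x y \<approx> (if k then x else y) : C"
proof (induction C arbitrary: \<Gamma> x y)
  case Base
  have "\<Gamma> \<turnstile> App b (Pair x y) \<approx> App (bool_tm k) (Pair x y) : Base"
    using conv_closed[OF b] Base unfolding Bool_ty_def by (blast intro: C_App C_refl T_Pair)
  then show ?case unfolding ite.simps using bool_tm_app[OF Base] by (rule C_trans)
next
  case (Fun A C)
  let ?x = "App (ren Suc x) (Var 0)" and ?y = "App (ren Suc y) (Var 0)"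
  have "A # \<Gamma> \<turnstile> ite C b ?x ?y \<approx> (if k then ?x else ?y) : C"
    by (intro Fun.IH(2) T_App[OF typing_shift typing_Var0] Fun.prems)
  then have "\<Gamma> \<turnstile> Lam A (ite C b ?x ?y) \<approx> Lam A (if k then ?x else ?y) : Fun A C"
    by (rule C_Lam)
  moreover have "\<Gamma> \<turnstile> Lam A (if k then ?x else ?y) \<approx> (if k then x else y) : Fun A C"
    using Fun.prems by (auto intro: C_eta)
  ultimately have "\<Gamma> \<turnstile> Lam A (ite C b ?x ?y) \<approx> (if k then x else y) : Fun A C"
    by (rule C_trans)
  \<comment> \<open>\<open>ite\<close> shifts its condition under the binder; the shift has no
    effect because \<open>b\<close> is closed.\<close>
  moreover have "ren Suc b = b" using ren_closed conv_typing[OF b] by blast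
  ultimately show ?case by simp
next
  case (Prod A C)
  have "\<Gamma> \<turnstile> ite A b (Fst x) (Fst y) \<approx> (if k then Fst x else Fst y) : A"
    by (rule Prod.IH(1)) (blast intro: T_Fst Prod.prems)+
  moreover have "\<Gamma> \<turnstile> ite C b (Snd x) (Snd y) \<approx> (if k then Snd x else Snd y) : C"
    by (rule Prod.IH(2)) (blast intro: T_Snd Prod.prems)+
  ultimately have "\<Gamma> \<turnstile> ite (Prod A C) b x y \<approx>
      Pair (if k then Fst x else Fst y) (if k then Snd x else Snd y) : Prod A C"
    by (auto intro: C_Pair)
  moreover have "\<Gamma> \<turnstile> Pair (if k then Fst x else Fst y) (if k then Snd x else Snd y) \<approx>
      (if k then x else y) : Prod A C"
    using Prod.prems by (auto intro: C_pair)
  ultimately show ?case by (rule C_trans)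
next
  case One
  then have "\<Gamma> \<turnstile> (if k then x else y) : One" by simp
  then show ?case unfolding ite.simps by (rule C_sym[OF C_unit])
qed

section \<open>Closed terms defining functions\<close>

lemma closed_beta:
  assumes "[D] \<turnstile> t : C" "[] \<turnstile> u : D"
  shows "[] \<turnstile> App (Lam D t) u \<approx> subst (inst u) t : C"
  using assms by (rule C_beta)

text \<open>This and the following lemmas export a closed abstraction only through its behaviour
  under application, so that tests and tables can be assembled later without computing
  substitutions.\<close>

lemma ex_const:
  assumes "[] \<turnstile> t : C"
  obtains g where "[] \<turnstile> g : Fun D C" "\<And>u. [] \<turnstile> u : D \<Longrightarrow> [] \<turnstile> App g u \<approx> t : C"
proof
  show "[] \<turnstile> Lam D t : Fun D C" by (rule T_Lam[OF typing_closed[OF assms]])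
  show "[] \<turnstile> App (Lam D t) u \<approx> t : C" if "[] \<turnstile> u : D" for u
    using closed_beta[OF typing_closed[OF assms] that] by (simp add: subst_closed[OF assms])
qed

lemma ex_comp:
  assumes g: "[] \<turnstile> g : Fun D E" and h: "[] \<turnstile> h : Fun E C"
  obtains k where "[] \<turnstile> k : Fun D C"
    "\<And>u. [] \<turnstile> u : D \<Longrightarrow> [] \<turnstile> App k u \<approx> App h (App g u) : C"
proof
  have t: "[D] \<turnstile> App h (App g (Var 0)) : C"
    by (intro T_App[OF typing_closed[OF h]] T_App[OF typing_closed[OF g]] typing_Var0)
  then show "[] \<turnstile> Lam D (App h (App g (Var 0))) : Fun D C" by (rule T_Lam)
  show "[] \<turnstile> App (Lam D (App h (App g (Var 0)))) u \<approx> App h (App g u) : C" if "[] \<turnstile> u : D" for u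
    using closed_beta[OF t that] by (simp add: subst_closed[OF g] subst_closed[OF h] inst_def)
qed

lemma ex_eval:
  assumes q: "[] \<turnstile> q : D"
  obtains k where "[] \<turnstile> k : Fun (Fun D C) C"
    "\<And>u. [] \<turnstile> u : Fun D C \<Longrightarrow> [] \<turnstile> App k u \<approx> App u q : C"
proof
  have t: "[Fun D C] \<turnstile> App (Var 0) q : C"
    by (rule T_App[OF typing_Var0 typing_closed[OF q]])
  then show "[] \<turnstile> Lam (Fun D C) (App (Var 0) q) : Fun (Fun D C) C" by (rule T_Lam)
  show "[] \<turnstile> App (Lam (Fun D C) (App (Var 0) q)) u \<approx> App u q : C" if "[] \<turnstile> u : Fun D C" for u
    using closed_beta[OF t that] by (simp add: subst_closed[OF q] inst_def)
qed

lemma ex_fst: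
  obtains k where "[] \<turnstile> k : Fun (Prod C D) C"
    "\<And>u. [] \<turnstile> u : Prod C D \<Longrightarrow> [] \<turnstile> App k u \<approx> Fst u : C"
proof
  have t: "[Prod C D] \<turnstile> Fst (Var 0) : C" by (blast intro: T_Fst typing_Var0)
  then show "[] \<turnstile> Lam (Prod C D) (Fst (Var 0)) : Fun (Prod C D) C" by (rule T_Lam)
  show "[] \<turnstile> App (Lam (Prod C D) (Fst (Var 0))) u \<approx> Fst u : C" if "[] \<turnstile> u : Prod C D" for u
    using closed_beta[OF t that] by (simp add: inst_def)
qed

lemma ex_snd:
  obtains k where "[] \<turnstile> k : Fun (Prod C D) D"
    "\<And>u. [] \<turnstile> u : Prod C D \<Longrightarrow> [] \<turnstile> App k u \<approx> Snd u : D"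
proof
  have t: "[Prod C D] \<turnstile> Snd (Var 0) : D" by (blast intro: T_Snd typing_Var0)
  then show "[] \<turnstile> Lam (Prod C D) (Snd (Var 0)) : Fun (Prod C D) D" by (rule T_Lam)
  show "[] \<turnstile> App (Lam (Prod C D) (Snd (Var 0))) u \<approx> Snd u : D" if "[] \<turnstile> u : Prod C D" for u
    using closed_beta[OF t that] by (simp add: inst_def)
qed

lemma ex_cond:
  assumes b: "[] \<turnstile> b : Fun D Bool_ty" and x: "[] \<turnstile> x : Fun D C" and y: "[] \<turnstile> y : Fun D C"
  obtains g where "[] \<turnstile> g : Fun D C"
    "\<And>u k. [] \<turnstile> u : D \<Longrightarrow> [] \<turnstile> App b u \<approx> bool_tm k : Bool_ty \<Longrightarrow>
      [] \<turnstile> App g u \<approx> (if k then App x u else App y u) : C"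
proof
  let ?t = "ite C (App b (Var 0)) (App x (Var 0)) (App y (Var 0))"
  have t: "[D] \<turnstile> ?t : C"
    by (intro typing_ite T_App[OF typing_closed typing_Var0] b x y)
  then show "[] \<turnstile> Lam D ?t : Fun D C" by (rule T_Lam)
  show "[] \<turnstile> App (Lam D ?t) u \<approx> (if k then App x u else App y u) : C"
    if u: "[] \<turnstile> u : D" and k: "[] \<turnstile> App b u \<approx> bool_tm k : Bool_ty" for u k
  proof (rule C_trans)
    show "[] \<turnstile> App (Lam D ?t) u \<approx> ite C (App b u) (App x u) (App y u) : C"
      using closed_beta[OF t u]
      by (simp add: subst_ite subst_closed[OF b] subst_closed[OF x] subst_closed[OF y] inst_def)
    show "[] \<turnstile> ite C (App b u) (App x u) (App y u) \<approx> (if k then App x u else App y u) : C"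
      by (rule ite_conv[OF k]) (blast intro: T_App x y u)+
  qed
qed

section \<open>Finite case distinctions and boolean connectives\<close>

text \<open>Each entry puts one more conditional in front of the table. The premise on
  \<open>u\<close> makes the test of \<open>a\<close> the only one that succeeds, so the order of
  the entries is irrelevant. The term \<open>d\<close> is the value of the empty table.\<close>

lemma ex_table:
  assumes "finite S" and d: "[] \<turnstile> d : C"
    and "\<And>a. a \<in> S \<Longrightarrow> [] \<turnstile> T a : Fun D Bool_ty" and "\<And>a. a \<in> S \<Longrightarrow> [] \<turnstile> r a : C"
  shows "\<exists>g. [] \<turnstile> g : Fun D C \<and> (\<forall>u. \<forall>a\<in>S. [] \<turnstile> u : D \<longrightarrow>
    (\<forall>a'\<in>S. [] \<turnstile> App (T a') u \<approx> bool_tm (a = a') : Bool_ty) \<longrightarrow> [] \<turnstile> App g u \<approx> r a : C)"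
  using assms(1,3,4)
proof (induction S rule: finite_induct)
  case empty
  obtain g where "[] \<turnstile> g : Fun D C" using ex_const[OF d, of D] by blast
  then show ?case by blast
next
  case (insert s S)
  obtain g where g: "[] \<turnstile> g : Fun D C" "\<And>u a. a \<in> S \<Longrightarrow> [] \<turnstile> u : D \<Longrightarrow>
      (\<forall>a'\<in>S. [] \<turnstile> App (T a') u \<approx> bool_tm (a = a') : Bool_ty) \<Longrightarrow> [] \<turnstile> App g u \<approx> r a : C"
    using insert.IH insert.prems by blast
  have s: "[] \<turnstile> T s : Fun D Bool_ty" "[] \<turnstile> r s : C" using insert.prems by auto
  obtain c where c: "[] \<turnstile> c : Fun D C" "\<And>u. [] \<turnstile> u : D \<Longrightarrow> [] \<turnstile> App c u \<approx> r s : C"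
    using ex_const[OF s(2), of D] by blast
  obtain h where h: "[] \<turnstile> h : Fun D C"
    "\<And>u k. [] \<turnstile> u : D \<Longrightarrow> [] \<turnstile> App (T s) u \<approx> bool_tm k : Bool_ty \<Longrightarrow>
      [] \<turnstile> App h u \<approx> (if k then App c u else App g u) : C"
    using ex_cond[OF s(1) c(1) g(1)] by blast
  have "[] \<turnstile> App h u \<approx> r a : C" if a: "a \<in> insert s S" and u: "[] \<turnstile> u : D"
    and T: "\<forall>a'\<in>insert s S. [] \<turnstile> App (T a') u \<approx> bool_tm (a = a') : Bool_ty" for u a
  proof (rule C_trans)
    show "[] \<turnstile> App h u \<approx> (if a = s then App c u else App g u) : C"
      using h(2)[OF u] T by simp
    show "[] \<turnstile> (if a = s then App c u else App g u) \<approx> r a : C"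
      using c(2)[OF u] g(2)[OF _ u, of a] a T by auto
  qed
  with h(1) show ?case by blast
qed

text \<open>The term \<open>g\<close> is a chain of conditionals built from the tests alone. It is
  fixed before \<open>P\<close>, so one term serves for all arguments and all combinations of
  answers.\<close>

lemma ex_conj:
  assumes "finite S" and "\<And>a. a \<in> S \<Longrightarrow> [] \<turnstile> T a : Fun D Bool_ty"
  shows "\<exists>g. [] \<turnstile> g : Fun D Bool_ty \<and> (\<forall>u P. [] \<turnstile> u : D \<longrightarrow>
    (\<forall>a\<in>S. [] \<turnstile> App (T a) u \<approx> bool_tm (P a) : Bool_ty) \<longrightarrow>
    [] \<turnstile> App g u \<approx> bool_tm (\<forall>a\<in>S. P a) : Bool_ty)"
  using assms
proof (induction S rule: finite_induct)
  case empty
  obtain g where "[] \<turnstile> g : Fun D Bool_ty"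
    "\<And>u. [] \<turnstile> u : D \<Longrightarrow> [] \<turnstile> App g u \<approx> bool_tm True : Bool_ty"
    using ex_const[OF typing_bool, of D] by blast
  then show ?case by auto
next
  case (insert s S)
  obtain g where g: "[] \<turnstile> g : Fun D Bool_ty" "\<And>u P. [] \<turnstile> u : D \<Longrightarrow>
      (\<forall>a\<in>S. [] \<turnstile> App (T a) u \<approx> bool_tm (P a) : Bool_ty) \<Longrightarrow>
      [] \<turnstile> App g u \<approx> bool_tm (\<forall>a\<in>S. P a) : Bool_ty"
    using insert.IH insert.prems by blast
  have s: "[] \<turnstile> T s : Fun D Bool_ty" using insert.prems by auto
  obtain c where c: "[] \<turnstile> c : Fun D Bool_ty"
    "\<And>u. [] \<turnstile> u : D \<Longrightarrow> [] \<turnstile> App c u \<approx> bool_tm False : Bool_ty"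
    using ex_const[OF typing_bool, of D] by blast
  obtain h where h: "[] \<turnstile> h : Fun D Bool_ty"
    "\<And>u k. [] \<turnstile> u : D \<Longrightarrow> [] \<turnstile> App (T s) u \<approx> bool_tm k : Bool_ty \<Longrightarrow>
      [] \<turnstile> App h u \<approx> (if k then App g u else App c u) : Bool_ty"
    using ex_cond[OF s g(1) c(1)] by blast
  have "[] \<turnstile> App h u \<approx> bool_tm (\<forall>a\<in>insert s S. P a) : Bool_ty" if u: "[] \<turnstile> u : D"
    and T: "\<forall>a\<in>insert s S. [] \<turnstile> App (T a) u \<approx> bool_tm (P a) : Bool_ty" for u P
  proof (rule C_trans)
    show "[] \<turnstile> App h u \<approx> (if P s then App g u else App c u) : Bool_ty"
      using h(2)[OF u] T by simp
    show "[] \<turnstile> (if P s then App g u else App c u) \<approx> bool_tm (\<forall>a\<in>insert s S. P a) : Bool_ty"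
      using c(2)[OF u] g(2)[OF u, of P] T by simp
  qed
  with h(1) show ?case by blast
qed

lemma ex_not:
  assumes T: "[] \<turnstile> T : Fun D Bool_ty"
  obtains g where "[] \<turnstile> g : Fun D Bool_ty"
    "\<And>u k. [] \<turnstile> u : D \<Longrightarrow> [] \<turnstile> App T u \<approx> bool_tm k : Bool_ty \<Longrightarrow>
      [] \<turnstile> App g u \<approx> bool_tm (\<not> k) : Bool_ty"
proof -
  have "\<exists>c. [] \<turnstile> c : Fun D Bool_ty \<and> (\<forall>u. [] \<turnstile> u : D \<longrightarrow> [] \<turnstile> App c u \<approx> bool_tm l : Bool_ty)" for l
    using ex_const[OF typing_bool, of D l] by blast
  then obtain c where c: "\<And>l. [] \<turnstile> c l : Fun D Bool_ty"
    "\<And>l u. [] \<turnstile> u : D \<Longrightarrow> [] \<turnstile> App (c l) u \<approx> bool_tm l : Bool_ty"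
    by metis
  obtain g where g: "[] \<turnstile> g : Fun D Bool_ty"
    "\<And>u k. [] \<turnstile> u : D \<Longrightarrow> [] \<turnstile> App T u \<approx> bool_tm k : Bool_ty \<Longrightarrow>
      [] \<turnstile> App g u \<approx> (if k then App (c False) u else App (c True) u) : Bool_ty"
    using ex_cond[OF T c(1) c(1)] by blast
  show thesis
  proof
    show "[] \<turnstile> g : Fun D Bool_ty" by (fact g)
    show "[] \<turnstile> App g u \<approx> bool_tm (\<not> k) : Bool_ty"
      if "[] \<turnstile> u : D" "[] \<turnstile> App T u \<approx> bool_tm k : Bool_ty" for u k
      by (rule C_trans[OF g(2)[OF that]]) (use c(2)[OF that(1)] in simp)
  qed
qed

section \<open>Encoding a finite set\<close>

text \<open>Each new element \<open>s\<close> puts a boolean flag in front of the codes, true for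
  \<open>s\<close> and false for the older elements; the first true flag identifies the element.
  Behind its flag the code of \<open>s\<close> needs some filling, hence the inhabitant
  \<open>d\<close> in the induction.\<close>

lemma ex_encoding:
  assumes "finite Q"
  shows "\<exists>B c T. (\<exists>d. [] \<turnstile> d : B) \<and> (\<forall>q\<in>Q. [] \<turnstile> c q : B \<and> [] \<turnstile> T q : Fun B Bool_ty \<and>
    (\<forall>p\<in>Q. [] \<turnstile> App (T q) (c p) \<approx> bool_tm (p = q) : Bool_ty))"
  using assms
proof (induction Q rule: finite_induct)
  case empty
  \<comment> \<open>The empty power of \<open>Bool_ty\<close> is \<open>One\<close>, inhabited by
    \<open>Unit\<close>.\<close>
  show ?case using T_Unit by blast
next
  case (insert s Q)
  obtain B c T d where d: "[] \<turnstile> d : B"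
    and c: "\<And>q. q \<in> Q \<Longrightarrow> [] \<turnstile> c q : B" and T: "\<And>q. q \<in> Q \<Longrightarrow> [] \<turnstile> T q : Fun B Bool_ty"
    and Tc: "\<And>q p. q \<in> Q \<Longrightarrow> p \<in> Q \<Longrightarrow> [] \<turnstile> App (T q) (c p) \<approx> bool_tm (p = q) : Bool_ty"
    using insert.IH by blast
  let ?B = "Prod Bool_ty B"
  define c' where "c' q = Pair (bool_tm (q = s)) (if q = s then d else c q)" for q
  have c': "[] \<turnstile> c' q : ?B" if "q \<in> insert s Q" for q
    using that c d by (auto simp: c'_def intro: T_Pair typing_bool)
  obtain f where f: "[] \<turnstile> f : Fun ?B Bool_ty"
    "\<And>u. [] \<turnstile> u : ?B \<Longrightarrow> [] \<turnstile> App f u \<approx> Fst u : Bool_ty"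
    using ex_fst by blast
  obtain g where g: "[] \<turnstile> g : Fun ?B B" "\<And>u. [] \<turnstile> u : ?B \<Longrightarrow> [] \<turnstile> App g u \<approx> Snd u : B"
    using ex_snd by blast
  obtain z where z: "[] \<turnstile> z : Fun ?B Bool_ty"
    "\<And>u. [] \<turnstile> u : ?B \<Longrightarrow> [] \<turnstile> App z u \<approx> bool_tm False : Bool_ty"
    using ex_const[OF typing_bool, of ?B] by blast
  have fc: "[] \<turnstile> App f (c' p) \<approx> bool_tm (p = s) : Bool_ty" if p: "p \<in> insert s Q" for p
  proof -
    have "[] \<turnstile> Fst (c' p) \<approx> bool_tm (p = s) : Bool_ty"
      unfolding c'_def using p c d by (auto intro!: C_fst typing_bool)
    then show ?thesis using f(2)[OF c'[OF p]] by (blast intro: C_trans)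
  qed
  have "\<exists>h. [] \<turnstile> h : Fun ?B Bool_ty \<and>
      (\<forall>p\<in>insert s Q. [] \<turnstile> App h (c' p) \<approx> bool_tm (p = q) : Bool_ty)" if q: "q \<in> insert s Q" for q
  proof (cases "q = s")
    case True
    then show ?thesis using f(1) fc by blast
  next
    case False
    with q have q: "q \<in> Q" by simp
    obtain k where k: "[] \<turnstile> k : Fun ?B Bool_ty"
      "\<And>u. [] \<turnstile> u : ?B \<Longrightarrow> [] \<turnstile> App k u \<approx> App (T q) (App g u) : Bool_ty"
      using ex_comp[OF g(1) T[OF q]] by blast
    \<comment> \<open>The flag is consulted before the old test: the code of \<open>s\<close>
      carries \<open>d\<close> behind its flag, and nothing is known about \<open>T q\<close> on
      \<open>d\<close>.\<close>
    obtain h where h: "[] \<turnstile> h : Fun ?B Bool_ty"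
      "\<And>u l. [] \<turnstile> u : ?B \<Longrightarrow> [] \<turnstile> App f u \<approx> bool_tm l : Bool_ty \<Longrightarrow>
        [] \<turnstile> App h u \<approx> (if l then App z u else App k u) : Bool_ty"
      using ex_cond[OF f(1) z(1) k(1)] by blast
    have "[] \<turnstile> App h (c' p) \<approx> bool_tm (p = q) : Bool_ty" if p: "p \<in> insert s Q" for p
    proof (rule C_trans)
      show "[] \<turnstile> App h (c' p) \<approx> (if p = s then App z (c' p) else App k (c' p)) : Bool_ty"
        by (rule h(2)[OF c'[OF p] fc[OF p]])
      show "[] \<turnstile> (if p = s then App z (c' p) else App k (c' p)) \<approx> bool_tm (p = q) : Bool_ty"
      proof (cases "p = s")
        case True
        then show ?thesis using z(2)[OF c'[OF p]] False by auto
      next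
        case ps: False
        with p have pQ: "p \<in> Q" by simp
        have "[] \<turnstile> Snd (c' p) \<approx> c p : B"
          unfolding c'_def using ps c[OF pQ] by (auto intro!: C_snd typing_bool)
        with g(2)[OF c'[OF p]] have "[] \<turnstile> App g (c' p) \<approx> c p : B" by (rule C_trans)
        then have "[] \<turnstile> App (T q) (App g (c' p)) \<approx> App (T q) (c p) : Bool_ty"
          using C_refl[OF T[OF q]] by (blast intro: C_App)
        then have "[] \<turnstile> App k (c' p) \<approx> bool_tm (p = q) : Bool_ty"
          using k(2)[OF c'[OF p]] Tc[OF q pQ] by (blast intro: C_trans)
        then show ?thesis using ps by simp
      qed
    qed
    with h(1) show ?thesis by blast
  qed
  then obtain T' where "\<And>q. q \<in> insert s Q \<Longrightarrow> [] \<turnstile> T' q : Fun ?B Bool_ty \<and>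
      (\<forall>p\<in>insert s Q. [] \<turnstile> App (T' q) (c' p) \<approx> bool_tm (p = q) : Bool_ty)"
    by metis
  moreover have "[] \<turnstile> Pair (bool_tm True) d : ?B" by (intro T_Pair typing_bool d)
  ultimately show ?case using c' by blast
qed

text \<open>Constant functions inhabit the arrow types, so one inhabitant of \<open>B\<close>
  suffices. The result supplies the default value required by \<open>ex_table\<close>.\<close>

lemma inhabited_ty_at:
  assumes "[] \<turnstile> d : B"
  shows "\<exists>t. [] \<turnstile> t : ty_at C B"
proof (induction C)
  case Base
  then show ?case using assms by auto
next
  case (Fun C1 C2)
  then show ?case by (auto intro: T_Lam dest: typing_closed)
next
  case (Prod C1 C2)
  then show ?case by (auto intro: T_Pair)
next
  case One
  then show ?case by (auto intro: T_Unit)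
qed

section \<open>The logical relation\<close>

text \<open>The arrow clause asks for membership in \<open>interp\<close> because the condition on
  related arguments does not by itself make \<open>v\<close> a function graph, and
  \<open>vapp\<close> is unspecified elsewhere. Typing is included so that \<open>u\<close> can be
  used in conversions.\<close>

primrec repr :: "'q set \<Rightarrow> ty \<Rightarrow> ('q \<Rightarrow> tm) \<Rightarrow> ty \<Rightarrow> 'q val \<Rightarrow> tm \<Rightarrow> bool" where
  "repr Q B c Base v u = (\<exists>q\<in>Q. v = VBase q \<and> [] \<turnstile> u \<approx> c q : B)"
| "repr Q B c (Fun A C) v u =
    (v \<in> interp Q (Fun A C) \<and> [] \<turnstile> u : ty_at (Fun A C) B \<and>
     (\<forall>a w. repr Q B c A a w \<longrightarrow> repr Q B c C (vapp v a) (App u w)))"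
| "repr Q B c (Prod A C) v u =
    (\<exists>a b. v = VPair a b \<and> [] \<turnstile> u : ty_at (Prod A C) B \<and>
      repr Q B c A a (Fst u) \<and> repr Q B c C b (Snd u))"
| "repr Q B c One v u = (v = VUnit \<and> [] \<turnstile> u : One)"

lemma repr_typing: "repr Q B c A v u \<Longrightarrow> [] \<turnstile> u : ty_at A B"
  by (cases A) (auto dest: conv_typing)

lemma repr_in_interp: "repr Q B c A v u \<Longrightarrow> v \<in> interp Q A"
proof (induction A arbitrary: v u)
  case (Fun A C)
  then show ?case unfolding repr.simps by blast
next
  case (Prod A C)
  then show ?case by auto
qed auto

lemma repr_conv: "repr Q B c A v u \<Longrightarrow> [] \<turnstile> u' \<approx> u : ty_at A B \<Longrightarrow> repr Q B c A v u'"
proof (induction A arbitrary: v u u')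
  case Base
  then show ?case unfolding repr.simps ty_at.simps by (blast intro: C_trans)
next
  case (Fun A C)
  have "repr Q B c C (vapp v a) (App u' w)" if w: "repr Q B c A a w" for a w
  proof (rule Fun.IH(2))
    show "repr Q B c C (vapp v a) (App u w)" using Fun.prems(1) w by simp
    show "[] \<turnstile> App u' w \<approx> App u w : ty_at C B"
      using Fun.prems(2) C_refl[OF repr_typing[OF w]] by (auto intro: C_App)
  qed
  moreover have "v \<in> interp Q (Fun A C)" by (rule repr_in_interp[OF Fun.prems(1)])
  moreover have "[] \<turnstile> u' : ty_at (Fun A C) B" using conv_typing[OF Fun.prems(2)] by blast
  ultimately show ?case unfolding repr.simps by blast
next
  case (Prod A C)
  obtain a b where v: "v = VPair a b" "repr Q B c A a (Fst u)" "repr Q B c C b (Snd u)"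
    using Prod.prems(1) by auto
  have u: "[] \<turnstile> u' \<approx> u : Prod (ty_at A B) (ty_at C B)" using Prod.prems(2) by simp
  show ?case
    using v(1) conv_typing[OF u] Prod.IH(1)[OF v(2) C_Fst[OF u]] Prod.IH(2)[OF v(3) C_Snd[OF u]]
    by simp
next
  case One
  then show ?case by (auto dest: conv_typing)
qed

section \<open>The fundamental lemma\<close>

text \<open>Open terms under related environments \<open>\<rho>\<close> and \<open>\<sigma>\<close>
  are needed for the induction to pass under abstractions; closed terms are the case of the empty
  context.\<close>

lemma repr_den:
  assumes Q: "finite Q"
  shows "\<Gamma> \<turnstile> t : A \<Longrightarrow> length \<rho> = length \<Gamma> \<Longrightarrow>
    (\<And>i. i < length \<Gamma> \<Longrightarrow> repr Q B c (\<Gamma> ! i) (\<rho> ! i) (\<sigma> i)) \<Longrightarrow>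
    repr Q B c A (den Q \<rho> t) (subst \<sigma> (tm_at t B))"
proof (induction arbitrary: \<rho> \<sigma> rule: typing.induct)
  case (T_Var i \<Gamma>)
  then show ?case by simp
next
  case (T_Lam A \<Gamma> t C)
  let ?t = "tm_at t B"
  have \<sigma>: "[] \<turnstile> \<sigma> i : ty_at (\<Gamma> ! i) B" if "i < length \<Gamma>" for i
    using repr_typing T_Lam.prems(2)[OF that] by blast
  have Lam: "[] \<turnstile> subst \<sigma> (tm_at (Lam A t) B) : ty_at (Fun A C) B"
    by (rule typing_subst[OF typing_tm_at[OF typing.T_Lam[OF T_Lam.hyps]]]) (simp add: \<sigma>)
  have body: "[ty_at A B] \<turnstile> subst (ups \<sigma>) ?t : ty_at C B"
    using Lam by (auto elim: typingE)
  have interp: "den Q \<rho> (Lam A t) \<in> interp Q (Fun A C)"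
    by (rule den_in_interp[OF Q typing.T_Lam[OF T_Lam.hyps]])
      (auto simp: list_all2_conv_all_nth T_Lam.prems(1) intro: repr_in_interp T_Lam.prems(2))
  have "repr Q B c C (vapp (den Q \<rho> (Lam A t)) a) (App (subst \<sigma> (tm_at (Lam A t) B)) w)"
    if w: "repr Q B c A a w" for a w
  proof (rule repr_conv)
    \<comment> \<open>\<open>?\<tau>\<close> sends 0 to \<open>w\<close> and otherwise acts as
      \<open>\<sigma>\<close> on the indices in scope: these terms are closed, so neither the shift
      nor the instantiation changes them.\<close>
    let ?\<tau> = "\<lambda>i. subst (inst w) (ups \<sigma> i)"
    have "repr Q B c C (den Q (a # \<rho>) t) (subst ?\<tau> ?t)"
    proof (rule T_Lam.IH)
      show "length (a # \<rho>) = length (A # \<Gamma>)" by (simp add: T_Lam.prems)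
      fix i assume i: "i < length (A # \<Gamma>)"
      show "repr Q B c ((A # \<Gamma>) ! i) ((a # \<rho>) ! i) (?\<tau> i)"
      proof (cases i)
        case 0
        then show ?thesis using w by (simp add: ups_def inst_def)
      next
        case (Suc j)
        then have "?\<tau> i = \<sigma> j"
          using i \<sigma>[of j] by (simp add: ups_def ren_closed subst_closed)
        then show ?thesis using Suc i T_Lam.prems(2)[of j] by simp
      qed
    qed
    then show "repr Q B c C (vapp (den Q \<rho> (Lam A t)) a) (subst (inst w) (subst (ups \<sigma>) ?t))"
      \<comment> \<open>\<open>vapp_graph\<close> performs the beta step on the semantic side, while
        \<open>subst_subst\<close> fuses the two substitutions on the term side.\<close>
      unfolding den.simps vapp_graph[OF Q repr_in_interp[OF w]] subst_subst .
    show "[] \<turnstile> App (subst \<sigma> (tm_at (Lam A t) B)) w \<approx> subst (inst w) (subst (ups \<sigma>) ?t) : ty_at C B"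
      using closed_beta[OF body repr_typing[OF w]] by simp
  qed
  with Lam interp show ?case unfolding repr.simps by blast
next
  case (T_App \<Gamma> t A C u)
  from T_App.IH[OF T_App.prems] show ?case by simp
next
  case (T_Pair \<Gamma> t A u C)
  let ?t = "subst \<sigma> (tm_at t B)" and ?u = "subst \<sigma> (tm_at u B)"
  have t: "repr Q B c A (den Q \<rho> t) ?t" by (rule T_Pair.IH(1)[OF T_Pair.prems])
  have u: "repr Q B c C (den Q \<rho> u) ?u" by (rule T_Pair.IH(2)[OF T_Pair.prems])
  note ty = repr_typing[OF t] repr_typing[OF u]
  show ?case
    using repr_conv[OF t C_fst[OF ty]] repr_conv[OF u C_snd[OF ty]] typing.T_Pair[OF ty] by simp
next
  case (T_Fst \<Gamma> t A C)
  from T_Fst.IH[OF T_Fst.prems] show ?case by auto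
next
  case (T_Snd \<Gamma> t A C)
  from T_Snd.IH[OF T_Snd.prems] show ?case by auto
next
  case (T_Unit \<Gamma>)
  then show ?case by (auto intro: typing.T_Unit)
qed

section \<open>Representatives and equality tests for all values\<close>

text \<open>By \<open>graph_vapp\<close> a function value is recovered from its results. Over a
  finite \<open>Q\<close> this reduces equality of functions to finitely many tests.\<close>

lemma vapp_ext:
  assumes "f \<in> interp Q (Fun A C)" "g \<in> interp Q (Fun A C)"
    and "\<And>a. a \<in> interp Q A \<Longrightarrow> vapp f a = vapp g a"
  shows "f = g"
proof -
  have "(\<lambda>a. (a, vapp f a)) ` interp Q A = (\<lambda>a. (a, vapp g a)) ` interp Q A"
    using assms(3) by (intro image_cong) auto
  then show ?thesis using graph_vapp[OF assms(1)] graph_vapp[OF assms(2)] by metis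
qed

text \<open>Nothing is demanded on arguments that represent no value; by \<open>repr_den\<close>,
  \<open>tm_at t B\<close> represents one for every well-typed closed \<open>t\<close>.\<close>

definition decides :: "'q set \<Rightarrow> ty \<Rightarrow> ('q \<Rightarrow> tm) \<Rightarrow> ty \<Rightarrow> 'q val \<Rightarrow> tm \<Rightarrow> bool" where
  "decides Q B c A d T \<longleftrightarrow> [] \<turnstile> T : Fun (ty_at A B) Bool_ty \<and>
    (\<forall>e u. repr Q B c A e u \<longrightarrow> [] \<turnstile> App T u \<approx> bool_tm (e = d) : Bool_ty)"

text \<open>The two claims need a joint induction: at an arrow type, a representative uses tests on
  the domain, and a test uses representatives of the domain.\<close>

lemma ex_repr_decides:
  assumes Q: "finite Q" and d: "[] \<turnstile> d : B"
    and enc: "\<forall>q\<in>Q. [] \<turnstile> c q : B \<and> [] \<turnstile> T q : Fun B Bool_ty \<and>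
      (\<forall>p\<in>Q. [] \<turnstile> App (T q) (c p) \<approx> bool_tm (p = q) : Bool_ty)"
  shows "\<forall>v\<in>interp Q A. (\<exists>u. repr Q B c A v u) \<and> (\<exists>t. decides Q B c A v t)"
proof (induction A)
  case Base
  have "decides Q B c Base (VBase q) (T q)" if q: "q \<in> Q" for q
  proof -
    have "[] \<turnstile> App (T q) u \<approx> bool_tm (p = q) : Bool_ty" if "p \<in> Q" "[] \<turnstile> u \<approx> c p : B" for p u
    proof (rule C_trans)
      show "[] \<turnstile> App (T q) u \<approx> App (T q) (c p) : Bool_ty"
        by (rule C_App[OF C_refl that(2)]) (use enc q in blast)
      show "[] \<turnstile> App (T q) (c p) \<approx> bool_tm (p = q) : Bool_ty"
        using enc q that(1) by blast
    qed
    then show ?thesis using enc q by (auto simp: decides_def)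
  qed
  moreover have "repr Q B c Base (VBase q) (c q)" if "q \<in> Q" for q
    using enc that by (auto intro: C_refl)
  ultimately show ?case by fastforce
next
  case (Fun A C)
  let ?A = "ty_at A B" and ?C = "ty_at C B"
  obtain qA tA where A: "\<And>a. a \<in> interp Q A \<Longrightarrow> repr Q B c A a (qA a)"
    "\<And>a. a \<in> interp Q A \<Longrightarrow> decides Q B c A a (tA a)" using Fun.IH(1) by metis
  obtain qC tC where C: "\<And>a. a \<in> interp Q C \<Longrightarrow> repr Q B c C a (qC a)"
    "\<And>a. a \<in> interp Q C \<Longrightarrow> decides Q B c C a (tC a)" using Fun.IH(2) by metis
  obtain d' where d': "[] \<turnstile> d' : ?C" using inhabited_ty_at[OF d] by blast
  show ?case
  proof (intro ballI conjI)
    fix f assume f: "f \<in> interp Q (Fun A C)"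
    note fa = vapp_in_interp[OF f]
    have "\<exists>g. [] \<turnstile> g : Fun ?A ?C \<and> (\<forall>u. \<forall>a\<in>interp Q A. [] \<turnstile> u : ?A \<longrightarrow>
      (\<forall>a'\<in>interp Q A. [] \<turnstile> App (tA a') u \<approx> bool_tm (a = a') : Bool_ty) \<longrightarrow>
      [] \<turnstile> App g u \<approx> qC (vapp f a) : ?C)"
    proof (rule ex_table[OF finite_interp[OF Q] d'])
      show "[] \<turnstile> tA a : Fun ?A Bool_ty" if "a \<in> interp Q A" for a
        using A(2)[OF that] by (simp add: decides_def)
      show "[] \<turnstile> qC (vapp f a) : ?C" if "a \<in> interp Q A" for a
        by (rule repr_typing[OF C(1)[OF fa[OF that]]])
    qed
    then obtain g where g: "[] \<turnstile> g : Fun ?A ?C"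
      "\<And>u a. a \<in> interp Q A \<Longrightarrow> [] \<turnstile> u : ?A \<Longrightarrow>
        (\<forall>a'\<in>interp Q A. [] \<turnstile> App (tA a') u \<approx> bool_tm (a = a') : Bool_ty) \<Longrightarrow>
        [] \<turnstile> App g u \<approx> qC (vapp f a) : ?C"
      by blast
    \<comment> \<open>Since \<open>w\<close> represents \<open>a\<close>, each test
      \<open>tA a'\<close> answers \<open>a = a'\<close> on it, and the table returns the entry of
      \<open>a\<close>.\<close>
    have "repr Q B c C (vapp f a) (App g w)" if w: "repr Q B c A a w" for a w
    proof (rule repr_conv[OF C(1)[OF fa[OF repr_in_interp[OF w]]] g(2)])
      show "\<forall>a'\<in>interp Q A. [] \<turnstile> App (tA a') w \<approx> bool_tm (a = a') : Bool_ty"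
        using A(2) w unfolding decides_def by blast
    qed (rule repr_in_interp[OF w], rule repr_typing[OF w])
    with f g(1) have "repr Q B c (Fun A C) f g" unfolding repr.simps ty_at.simps by blast
    then show "\<exists>u. repr Q B c (Fun A C) f u" ..
    \<comment> \<open>The term \<open>k\<close> applies its argument to the representative of
      \<open>a\<close> and tests whether the result represents \<open>vapp f a\<close>.\<close>
    have "\<exists>k. [] \<turnstile> k : Fun (Fun ?A ?C) Bool_ty \<and>
        (\<forall>u. [] \<turnstile> u : Fun ?A ?C \<longrightarrow> [] \<turnstile> App k u \<approx> App (tC (vapp f a)) (App u (qA a)) : Bool_ty)"
      if a: "a \<in> interp Q A" for a
    proof -
      obtain e where e: "[] \<turnstile> e : Fun (Fun ?A ?C) ?C"
        "\<And>u. [] \<turnstile> u : Fun ?A ?C \<Longrightarrow> [] \<turnstile> App e u \<approx> App u (qA a) : ?C"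
        using ex_eval[OF repr_typing[OF A(1)[OF a]]] by blast
      have t: "[] \<turnstile> tC (vapp f a) : Fun ?C Bool_ty"
        using C(2)[OF fa[OF a]] by (simp add: decides_def)
      obtain k where k: "[] \<turnstile> k : Fun (Fun ?A ?C) Bool_ty"
        "\<And>u. [] \<turnstile> u : Fun ?A ?C \<Longrightarrow> [] \<turnstile> App k u \<approx> App (tC (vapp f a)) (App e u) : Bool_ty"
        using ex_comp[OF e(1) t] by blast
      have "[] \<turnstile> App k u \<approx> App (tC (vapp f a)) (App u (qA a)) : Bool_ty"
        if "[] \<turnstile> u : Fun ?A ?C" for u
        using k(2)[OF that] C_App[OF C_refl[OF t] e(2)[OF that]] by (rule C_trans)
      with k(1) show ?thesis by blast
    qed
    then obtain k where k: "\<And>a. a \<in> interp Q A \<Longrightarrow> [] \<turnstile> k a : Fun (Fun ?A ?C) Bool_ty"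
      "\<And>a u. a \<in> interp Q A \<Longrightarrow> [] \<turnstile> u : Fun ?A ?C \<Longrightarrow>
        [] \<turnstile> App (k a) u \<approx> App (tC (vapp f a)) (App u (qA a)) : Bool_ty"
      by metis
    obtain t where t: "[] \<turnstile> t : Fun (Fun ?A ?C) Bool_ty"
      "\<And>u P. [] \<turnstile> u : Fun ?A ?C \<Longrightarrow>
        (\<forall>a\<in>interp Q A. [] \<turnstile> App (k a) u \<approx> bool_tm (P a) : Bool_ty) \<Longrightarrow>
        [] \<turnstile> App t u \<approx> bool_tm (\<forall>a\<in>interp Q A. P a) : Bool_ty"
      using ex_conj[of "interp Q A" k, OF finite_interp[OF Q] k(1)] by blast
    have "[] \<turnstile> App t u \<approx> bool_tm (e = f) : Bool_ty" if u: "repr Q B c (Fun A C) e u" for e u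
    proof -
      have ty: "[] \<turnstile> u : Fun ?A ?C" using repr_typing[OF u] by simp
      have "[] \<turnstile> App (k a) u \<approx> bool_tm (vapp e a = vapp f a) : Bool_ty" if a: "a \<in> interp Q A" for a
      proof (rule C_trans[OF k(2)[OF a ty]])
        have "repr Q B c C (vapp e a) (App u (qA a))" using u A(1)[OF a] by simp
        then show "[] \<turnstile> App (tC (vapp f a)) (App u (qA a)) \<approx>
            bool_tm (vapp e a = vapp f a) : Bool_ty"
          using C(2)[OF fa[OF a]] unfolding decides_def by blast
      qed
      then have "[] \<turnstile> App t u \<approx> bool_tm (\<forall>a\<in>interp Q A. vapp e a = vapp f a) : Bool_ty"
        by (intro t(2)[OF ty] ballI)
      moreover have "(\<forall>a\<in>interp Q A. vapp e a = vapp f a) \<longleftrightarrow> e = f"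
        using vapp_ext[OF repr_in_interp[OF u] f] by blast
      ultimately show ?thesis by simp
    qed
    with t(1) have "decides Q B c (Fun A C) f t" by (simp add: decides_def)
    then show "\<exists>t. decides Q B c (Fun A C) f t" ..
  qed
next
  case (Prod A C)
  let ?A = "ty_at A B" and ?C = "ty_at C B"
  have "(\<exists>u. repr Q B c (Prod A C) (VPair a b) u) \<and> (\<exists>t. decides Q B c (Prod A C) (VPair a b) t)"
    if a: "a \<in> interp Q A" and b: "b \<in> interp Q C" for a b
  proof
    obtain qa ta qb tb where q: "repr Q B c A a qa" "repr Q B c C b qb"
      and t: "decides Q B c A a ta" "decides Q B c C b tb"
      using Prod.IH a b by metis
    note ty = repr_typing[OF q(1)] repr_typing[OF q(2)]
    have "repr Q B c (Prod A C) (VPair a b) (Pair qa qb)"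
      using repr_conv[OF q(1) C_fst[OF ty]] repr_conv[OF q(2) C_snd[OF ty]] T_Pair[OF ty] by simp
    then show "\<exists>u. repr Q B c (Prod A C) (VPair a b) u" ..
    have tty: "[] \<turnstile> ta : Fun ?A Bool_ty" "[] \<turnstile> tb : Fun ?C Bool_ty"
      using t by (auto simp: decides_def)
    obtain f where f: "[] \<turnstile> f : Fun (Prod ?A ?C) ?A"
      "\<And>u. [] \<turnstile> u : Prod ?A ?C \<Longrightarrow> [] \<turnstile> App f u \<approx> Fst u : ?A"
      using ex_fst by blast
    obtain g where g: "[] \<turnstile> g : Fun (Prod ?A ?C) ?C"
      "\<And>u. [] \<turnstile> u : Prod ?A ?C \<Longrightarrow> [] \<turnstile> App g u \<approx> Snd u : ?C"
      using ex_snd by blast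
    obtain h where h: "[] \<turnstile> h : Fun (Prod ?A ?C) Bool_ty"
      "\<And>u. [] \<turnstile> u : Prod ?A ?C \<Longrightarrow> [] \<turnstile> App h u \<approx> App ta (App f u) : Bool_ty"
      using ex_comp[OF f(1) tty(1)] by blast
    obtain k where k: "[] \<turnstile> k : Fun (Prod ?A ?C) Bool_ty"
      "\<And>u. [] \<turnstile> u : Prod ?A ?C \<Longrightarrow> [] \<turnstile> App k u \<approx> App tb (App g u) : Bool_ty"
      using ex_comp[OF g(1) tty(2)] by blast
    \<comment> \<open>This is the conjunction of \<open>h\<close> and \<open>k\<close>: the else
      branch is reached only when \<open>h\<close> is false, so \<open>h\<close> itself is the right
      answer there.\<close>
    obtain t' where t': "[] \<turnstile> t' : Fun (Prod ?A ?C) Bool_ty"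
      "\<And>u l. [] \<turnstile> u : Prod ?A ?C \<Longrightarrow> [] \<turnstile> App h u \<approx> bool_tm l : Bool_ty \<Longrightarrow>
        [] \<turnstile> App t' u \<approx> (if l then App k u else App h u) : Bool_ty"
      using ex_cond[OF h(1) k(1) h(1)] by blast
    have "[] \<turnstile> App t' u \<approx> bool_tm (e = VPair a b) : Bool_ty"
      if u: "repr Q B c (Prod A C) e u" for e u
    proof -
      obtain x y where e: "e = VPair x y" and x: "repr Q B c A x (Fst u)"
        and y: "repr Q B c C y (Snd u)" using u by auto
      have ty: "[] \<turnstile> u : Prod ?A ?C" using repr_typing[OF u] by simp
      have "[] \<turnstile> App ta (Fst u) \<approx> bool_tm (x = a) : Bool_ty"
        using t(1) x by (simp add: decides_def)
      then have hu: "[] \<turnstile> App h u \<approx> bool_tm (x = a) : Bool_ty"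
        by (rule C_trans[OF C_trans[OF h(2)[OF ty] C_App[OF C_refl[OF tty(1)] f(2)[OF ty]]]])
      have "[] \<turnstile> App tb (Snd u) \<approx> bool_tm (y = b) : Bool_ty"
        using t(2) y by (simp add: decides_def)
      then have ku: "[] \<turnstile> App k u \<approx> bool_tm (y = b) : Bool_ty"
        by (rule C_trans[OF C_trans[OF k(2)[OF ty] C_App[OF C_refl[OF tty(2)] g(2)[OF ty]]]])
      show ?thesis by (rule C_trans[OF t'(2)[OF ty hu]]) (use hu ku e in auto)
    qed
    with t'(1) have "decides Q B c (Prod A C) (VPair a b) t'" by (simp add: decides_def)
    then show "\<exists>t. decides Q B c (Prod A C) (VPair a b) t" ..
  qed
  then show ?case by auto
next
  case One
  obtain t where "[] \<turnstile> t : Fun One Bool_ty"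
    "\<And>u. [] \<turnstile> u : One \<Longrightarrow> [] \<turnstile> App t u \<approx> bool_tm True : Bool_ty"
    using ex_const[OF typing_bool, of One] by blast
  then have "decides Q B c One VUnit t" by (simp add: decides_def)
  then show ?case by (auto intro: T_Unit)
qed

section \<open>The recognizing term\<close>

theorem theorem6p5:
  fixes A :: ty and Q :: "'q set" and F :: "'q val set"
  assumes "finite Q" and "F \<subseteq> interp Q A"
  shows "\<exists>B :: ty. \<exists>r \<in> Tm (Fun (ty_at A B) Bool_ty).
    {t \<in> Tm A. cden Q t \<in> F} = {t \<in> Tm A. capp r (ctm_at t B) = true_tm}"
proof -
  obtain B c T d where d: "[] \<turnstile> d : B" and enc: "\<forall>q\<in>Q. [] \<turnstile> c q : B \<and> [] \<turnstile> T q : Fun B Bool_ty \<and>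
      (\<forall>p\<in>Q. [] \<turnstile> App (T q) (c p) \<approx> bool_tm (p = q) : Bool_ty)"
    using ex_encoding[OF assms(1)] by blast
  let ?A = "ty_at A B"
  have "\<exists>t. decides Q B c A v t" if "v \<in> F" for v
    using ex_repr_decides[OF assms(1) d enc] assms(2) that by blast
  then obtain t where t: "\<And>v. v \<in> F \<Longrightarrow> decides Q B c A v (t v)" by metis
  \<comment> \<open>The disjunction over \<open>F\<close> is obtained by De Morgan:
    \<open>n v\<close> negates the test for \<open>v\<close>, \<open>g\<close> is the conjunction of
    these negations, and \<open>r\<close> negates \<open>g\<close>.\<close>
  have "\<exists>g. [] \<turnstile> g : Fun ?A Bool_ty \<and> (\<forall>u k. [] \<turnstile> u : ?A \<longrightarrow>
      [] \<turnstile> App (t v) u \<approx> bool_tm k : Bool_ty \<longrightarrow> [] \<turnstile> App g u \<approx> bool_tm (\<not> k) : Bool_ty)"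
    if v: "v \<in> F" for v
  proof -
    have "[] \<turnstile> t v : Fun ?A Bool_ty" using t[OF v] by (simp add: decides_def)
    from ex_not[OF this] show ?thesis by blast
  qed
  then obtain n where n: "\<And>v. v \<in> F \<Longrightarrow> [] \<turnstile> n v : Fun ?A Bool_ty"
    "\<And>v u k. v \<in> F \<Longrightarrow> [] \<turnstile> u : ?A \<Longrightarrow> [] \<turnstile> App (t v) u \<approx> bool_tm k : Bool_ty \<Longrightarrow>
      [] \<turnstile> App (n v) u \<approx> bool_tm (\<not> k) : Bool_ty"
    by metis
  have "finite F" using finite_subset[OF assms(2) finite_interp[OF assms(1)]] .
  from ex_conj[of F n, OF this n(1)] obtain g where g: "[] \<turnstile> g : Fun ?A Bool_ty"
    "\<And>u P. [] \<turnstile> u : ?A \<Longrightarrow> (\<forall>v\<in>F. [] \<turnstile> App (n v) u \<approx> bool_tm (P v) : Bool_ty) \<Longrightarrow>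
      [] \<turnstile> App g u \<approx> bool_tm (\<forall>v\<in>F. P v) : Bool_ty"
    by blast
  obtain r where r: "[] \<turnstile> r : Fun ?A Bool_ty"
    "\<And>u k. [] \<turnstile> u : ?A \<Longrightarrow> [] \<turnstile> App g u \<approx> bool_tm k : Bool_ty \<Longrightarrow>
      [] \<turnstile> App r u \<approx> bool_tm (\<not> k) : Bool_ty"
    using ex_not[OF g(1)] by blast
  have "cden Q (cls s) \<in> F \<longleftrightarrow> capp (cls r) (ctm_at (cls s) B) = true_tm" if s: "[] \<turnstile> s : A" for s
  proof -
    let ?s = "tm_at s B"
    have ty: "[] \<turnstile> ?s : ?A" using typing_tm_at[OF s] by simp
    \<comment> \<open>In the empty context any substitution is admissible; \<open>Var\<close> is
      chosen, and closedness of \<open>?s\<close> then removes it.\<close>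
    have "repr Q B c A (den Q [] s) (subst Var ?s)"
      by (rule repr_den[OF assms(1) s]) auto
    then have "repr Q B c A (den Q [] s) ?s" by (simp add: subst_closed[OF ty])
    then have "[] \<turnstile> App (t v) ?s \<approx> bool_tm (den Q [] s = v) : Bool_ty" if "v \<in> F" for v
      using t[OF that] by (simp add: decides_def)
    then have "\<forall>v\<in>F. [] \<turnstile> App (n v) ?s \<approx> bool_tm (den Q [] s \<noteq> v) : Bool_ty"
      using n(2)[OF _ ty] by blast
    from r(2)[OF ty g(2)[OF ty this]]
    have rs: "[] \<turnstile> App r ?s \<approx> bool_tm (den Q [] s \<in> F) : Bool_ty"
      by simp
    have "capp (cls r) (ctm_at (cls s) B) = true_tm \<longleftrightarrow> cls (App r ?s) = cls (bool_tm True)"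
      by (simp add: ctm_at_cls[OF s] capp_cls[OF r(1) ty] true_tm_def bool_tm_def)
    also have "\<dots> \<longleftrightarrow> [] \<turnstile> App r ?s \<approx> bool_tm True : Bool_ty"
      by (rule cls_eq_iff[OF T_App[OF r(1) ty]])
    also have "\<dots> \<longleftrightarrow> den Q [] s \<in> F"
    proof
      \<comment> \<open>Both boolean values of \<open>App r ?s\<close> are convertible to each
        other, so \<open>bool_tm_inject\<close> identifies them.\<close>
      assume "[] \<turnstile> App r ?s \<approx> bool_tm True : Bool_ty"
      from bool_tm_inject[OF C_trans[OF C_sym[OF this] rs]] show "den Q [] s \<in> F" by simp
    qed (use rs in simp)
    finally show ?thesis by (simp add: cden_cls[OF assms(1) s])
  qed
  then have "{t \<in> Tm A. cden Q t \<in> F} = {t \<in> Tm A. capp (cls r) (ctm_at t B) = true_tm}"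
    by (auto simp: Tm_iff)
  moreover have "cls r \<in> Tm (Fun ?A Bool_ty)" using r(1) by (auto simp: Tm_iff)
  ultimately show ?thesis by blast
qed

end
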